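(* For each fixed $\varepsilon\in(\pi/3,2\pi/3)$, \[F_2(\varepsilon,n)=\Omega\left(n^{\log_2 C_2(\varepsilon)}\right)\quad\text{as } n\to\infty,\qquad\text{where } C_2(\varepsilon)=\left(2\sin\left(\tfrac{\pi}{3}-\tfrac{\varepsilon}{2}\right)\right)^{-1}.\] Also, $F_2(\pi/3,n)=\Omega(\log n)$ as $n\to\infty$.
   Context: A Steiner topology for $n$ terminals is a (graph-theoretic) tree $\mathcal{T}$ with $n$ special vertices $t_1,\dots,t_n$, called terminals, all of degree at most $3$, and all other vertices, called Steiner points, of degree exactly $3$. It is full if all terminals have degree $1$. Given a family $p_1,\dots,p_n$ of points in $\mathbb{R}^d$ (repetitions allowed), a Steiner tree with topology $\mathcal{T}$ on these points is a representation of $\mathcal{T}$ in $\mathbb{R}^d$ in which $t_i$ is represented by $p_i$, each Steiner point by an arbitrary point of $\mathbb{R}^d$, and each edge by a straight-line segment; points may coincide (so edges may have length $0$; such edges, and trees containing them, are called degenerate) and edges may cross. The length $L(T)$ is the sum of the Euclidean lengths of the edges. Angles are measured in $[0,\pi]$. For $\varepsilon\geq 0$, an $\varepsilon$-approximate Steiner tree is a tree with a Steiner topology such that at each Steiner point all three angles spanned by pairs of incident edges belong to $[2\pi/3-\varepsilon,2\pi/3+\varepsilon]$ (in particular these angles are defined, so edges at Steiner points have positive length). $\mathcal{A}_\varepsilon^d(n)$ denotes the set of all $\varepsilon$-approximate Steiner trees in $\mathbb{R}^d$ with full Steiner topology on $n$ terminals. For a tree $T$ in $\mathbb{R}^d$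 with Steiner topology $\mathcal{T}$, $S(T)$ denotes the (unique) shortest tree in $\mathbb{R}^d$ on the terminals of $T$ with topology $\mathcal{T}$, where degenerate trees are allowed. Define \[F_d(\varepsilon,n)=\sup\left\{\frac{L(T)-L(S(T))}{L(S(T))}: T\in\mathcal{A}_\varepsilon^d(n)\right\}.\] Here $f(n)=\Omega(g(n))$ means that there is a constant $c>0$ (possibly depending on $\varepsilon$) with $f(n)\geq c\,g(n)$ for all sufficiently large $n$. *)

theory Defs
  imports "HOL-Analysis.Analysis"
begin

section \<open>Finite simple graphs and trees\<close>

text \<open>Edges are two-element sets of vertices.\<close>

definition simple_graph :: "'v set \<Rightarrow> 'v set set \<Rightarrow> bool" where
  "simple_graph V E \<longleftrightarrow> finite V \<and> (\<forall>e\<in>E. \<exists>u\<in>V. \<exists>v\<in>V. u \<noteq> v \<and> e = {u, v})"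

definition graph_connected :: "'v set \<Rightarrow> 'v set set \<Rightarrow> bool" where
  "graph_connected V E \<longleftrightarrow> V \<noteq> {} \<and> (\<forall>u\<in>V. \<forall>v\<in>V. (u, v) \<in> {(x, y). {x, y} \<in> E}\<^sup>*)"

definition graph_cycle :: "'v set set \<Rightarrow> 'v list \<Rightarrow> bool" where
  "graph_cycle E c \<longleftrightarrow> length c \<ge> 3 \<and> distinct c \<and>
     (\<forall>i<length c. {c ! i, c ! (Suc i mod length c)} \<in> E)"

definition graph_tree :: "'v set \<Rightarrow> 'v set set \<Rightarrow> bool" where
  "graph_tree V E \<longleftrightarrow> simple_graph V E \<and> graph_connected V E \<and> (\<nexists>c. graph_cycle E c)"

definition graph_degree :: "'v set set \<Rightarrow> 'v \<Rightarrow> nat" where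
  "graph_degree E v = card {e \<in> E. v \<in> e}"

section \<open>Steiner topologies\<close>

text \<open>The list \<open>terms\<close> enumerates the terminals \<open>t\<^sub>1, \<dots>, t\<^sub>n\<close>, so \<open>n\<close> is its length.\<close>

record 'v topology_graph =
  verts :: "'v set"
  edges :: "'v set set"
  terms :: "'v list"

definition steiner_points :: "'v topology_graph \<Rightarrow> 'v set" where
  "steiner_points G = verts G - set (terms G)"

definition steiner_topology :: "nat \<Rightarrow> 'v topology_graph \<Rightarrow> bool" where
  "steiner_topology n G \<longleftrightarrow>
     graph_tree (verts G) (edges G) \<and>
     length (terms G) = n \<and> distinct (terms G) \<and> set (terms G) \<subseteq> verts G \<and>
     (\<forall>t\<in>set (terms G). graph_degree (edges G) t \<le> 3) \<and>
     (\<forall>s\<in>steiner_points G. graph_degree (edges G) s = 3)"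

definition full_topology :: "'v topology_graph \<Rightarrow> bool" where
  "full_topology G \<longleftrightarrow> (\<forall>t\<in>set (terms G). graph_degree (edges G) t = 1)"

section \<open>Steiner trees\<close>

text \<open>A Steiner tree with topology \<open>G\<close> is a map \<open>p\<close> sending each vertex to a point (only its
  values on \<open>verts G\<close> matter); its given points are \<open>p t\<^sub>1, \<dots>, p t\<^sub>n\<close>. The map need not be
  injective, so degenerate edges and crossings are allowed.\<close>

definition edge_length :: "('v \<Rightarrow> 'a::metric_space) \<Rightarrow> 'v set \<Rightarrow> real" where
  "edge_length p e = diameter (p ` e)"

lemma edge_length_doubleton:
  fixes p :: "'v \<Rightarrow> 'a::metric_space"
  shows "edge_length p {u, v} = dist (p u) (p v)"
proof -
  have "diameter {x, y} = dist x y" for x y :: 'a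
  proof (rule antisym)
    have "bounded {x, y}" by simp
    then show "dist x y \<le> diameter {x, y}"
      by (rule diameter_bounded_bound) auto
    show "diameter {x, y} \<le> dist x y"
    proof -
      have "(SUP (a, b)\<in>{x, y} \<times> {x, y}. dist a b) \<le> dist x y"
        by (rule cSUP_least) (auto simp only: insert_not_empty, auto simp: dist_commute)
      then show ?thesis by (simp only: diameter_def insert_not_empty if_False)
    qed
  qed
  then show ?thesis by (simp add: edge_length_def)
qed

definition tree_length :: "'v topology_graph \<Rightarrow> ('v \<Rightarrow> 'a::metric_space) \<Rightarrow> real" where
  "tree_length G p = (\<Sum>e\<in>edges G. edge_length p e)"

definition same_terminals :: "'v topology_graph \<Rightarrow> ('v \<Rightarrow> 'a) \<Rightarrow> ('v \<Rightarrow> 'a) \<Rightarrow> bool" where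
  "same_terminals G p q \<longleftrightarrow> (\<forall>t\<in>set (terms G). q t = p t)"

definition is_shortest_tree ::
    "'v topology_graph \<Rightarrow> ('v \<Rightarrow> 'a::metric_space) \<Rightarrow> ('v \<Rightarrow> 'a) \<Rightarrow> bool" where
  "is_shortest_tree G p q \<longleftrightarrow> same_terminals G p q \<and>
     (\<forall>r. same_terminals G p r \<longrightarrow> tree_length G q \<le> tree_length G r)"

text \<open>\<open>S(T)\<close>; existence is the lemma \<open>shortest_tree\<close> below. The values outside
  \<open>verts G\<close> are unspecified and do not affect the length.\<close>

definition shortest_tree ::
    "'v topology_graph \<Rightarrow> ('v \<Rightarrow> 'a::metric_space) \<Rightarrow> 'v \<Rightarrow> 'a" where
  "shortest_tree G p = (SOME q. is_shortest_tree G p q)"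

lemma edge_length_le_tree_length:
  assumes "simple_graph (verts G) (edges G)" and "{u, v} \<in> edges G"
  shows "dist (p u) (p v) \<le> tree_length G p"
proof -
  have "edges G \<subseteq> Pow (verts G)" "finite (verts G)"
    using assms(1) by (auto simp: simple_graph_def)
  then have fin: "finite (edges G)"
    by (meson finite_Pow_iff finite_subset)
  have nn: "edge_length p e \<ge> 0" if "e \<in> edges G" for e
    using that assms(1) by (auto simp: simple_graph_def edge_length_doubleton)
  show ?thesis
    unfolding tree_length_def
    using member_le_sum[OF assms(2), of "edge_length p"] nn fin
    by (simp add: edge_length_doubleton)
qed

lemma is_shortest_tree_exists:
  fixes p :: "'v \<Rightarrow> 'a::euclidean_space"
  assumes "graph_tree (verts G) (edges G)"
  shows "\<exists>q. is_shortest_tree G p q"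
proof -
  define R where "R = {(x, y). {x, y} \<in> edges G}"
  define L where "L = tree_length G p"
  have G: "simple_graph (verts G) (edges G)" "graph_connected (verts G) (edges G)"
    using assms by (auto simp: graph_tree_def)
  have "R \<subseteq> verts G \<times> verts G"
    using G(1) by (fastforce simp: R_def simple_graph_def doubleton_eq_iff)
  moreover have "finite (verts G)" using G(1) by (simp add: simple_graph_def)
  ultimately have finR: "finite R" by (meson finite_SigmaI finite_subset)
  show ?thesis
  proof (cases "set (terms G) \<inter> verts G = {}")
    case True
    define q where "q = (\<lambda>v. if v \<in> verts G then (0::'a) else p v)"
    have e0: "edge_length q e = 0" if "e \<in> edges G" for e
      using that G(1) by (auto simp: simple_graph_def edge_length_doubleton q_def)
    have "same_terminals G p q"
      using True by (auto simp: same_terminals_def q_def)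
    moreover have "tree_length G q \<le> tree_length G r" for r :: "'v \<Rightarrow> 'a"
    proof -
      have "edge_length r e \<ge> 0" if "e \<in> edges G" for e
        using that G(1) by (auto simp: simple_graph_def edge_length_doubleton)
      then show ?thesis using e0 by (simp add: tree_length_def sum_nonneg)
    qed
    ultimately show ?thesis unfolding is_shortest_tree_def by blast
  next
    case False
    then obtain w where w: "w \<in> set (terms G)" "w \<in> verts G" by auto
    define K where "K = PiE UNIV (\<lambda>v. if v \<in> set (terms G) \<or> v \<notin> verts G then {p v}
                                    else cball (p w) (real (card R) * L))"
    have bound: "dist (q u) (q v) \<le> real k * M"
      if "(u, v) \<in> R ^^ k" "M \<ge> tree_length G q" for u v k M and q :: "'v \<Rightarrow> 'a"
      using that
    proof (induction k arbitrary: v)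
      case (Suc k)
      then obtain x where x: "(u, x) \<in> R ^^ k" "(x, v) \<in> R" by auto
      have "dist (q x) (q v) \<le> M"
        using edge_length_le_tree_length[OF G(1), of x v q] x Suc.prems by (simp add: R_def)
      with Suc.IH[OF x(1) Suc.prems(2)] show ?case
        using dist_triangle[of "q u" "q v" "q x"] by (simp add: algebra_simps)
    qed simp
    have L0: "L \<ge> 0"
      using G(1) unfolding L_def tree_length_def
      by (intro sum_nonneg) (auto simp: simple_graph_def edge_length_doubleton)
    have inK: "(\<lambda>v. if v \<in> verts G then q v else p v) \<in> K"
      if q: "same_terminals G p q" "tree_length G q \<le> L" for q
    proof -
      have "dist (p w) (q v) \<le> real (card R) * L" if "v \<in> verts G" for v
      proof -
        have "(w, v) \<in> R\<^sup>*" using G(2) w that by (auto simp: graph_connected_def R_def)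
        then obtain k where k: "k \<le> card R" "(w, v) \<in> R ^^ k"
          using rtrancl_finite_eq_relpow[OF finR] by auto
        have "dist (q w) (q v) \<le> real k * L" by (rule bound[OF k(2) q(2)])
        also have "\<dots> \<le> real (card R) * L" using k L0 by (intro mult_right_mono) auto
        finally show ?thesis using q(1) w by (simp add: same_terminals_def)
      qed
      then show ?thesis using q(1) by (auto simp: K_def same_terminals_def)
    qed
    have K_compact: "compact K"
    proof -
      have "compactin (product_topology (\<lambda>_. euclidean) UNIV) K"
        unfolding K_def compactin_PiE by auto
      then show ?thesis by (simp add: euclidean_product_topology)
    qed
    have cont: "continuous_on K (tree_length G)"
      unfolding tree_length_def
    proof (intro continuous_on_sum)
      fix e assume "e \<in> edges G"
      then obtain u v where e: "e = {u, v}" using G(1) by (auto simp: simple_graph_def)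
      have *: "continuous_on K (\<lambda>q. q i)" for i :: 'v
        by (rule continuous_on_subset[OF continuous_on_product_coordinates subset_UNIV])
      show "continuous_on K (\<lambda>q. edge_length q e)"
        unfolding e edge_length_doubleton by (intro continuous_on_dist *)
    qed
    have eq: "tree_length G (\<lambda>v. if v \<in> verts G then q v else p v) = tree_length G q"
      for q :: "'v \<Rightarrow> 'a"
      unfolding tree_length_def using G(1)
      by (intro sum.cong) (auto simp: simple_graph_def edge_length_doubleton)
    have pK: "p \<in> K" using inK[of p] by (simp add: same_terminals_def L_def)
    then obtain q where q: "q \<in> K" "\<And>r. r \<in> K \<Longrightarrow> tree_length G q \<le> tree_length G r"
      using continuous_attains_inf[OF K_compact _ cont] by blast
    have "same_terminals G p q"
      unfolding same_terminals_def
    proof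
      fix t assume "t \<in> set (terms G)"
      then show "q t = p t"
        using q(1) by (auto simp: K_def PiE_def Pi_def dest!: spec[of _ t])
    qed
    moreover have "tree_length G q \<le> tree_length G r" if "same_terminals G p r" for r
    proof (cases "tree_length G r \<le> L")
      case True
      then show ?thesis using q(2)[OF inK[OF that True]] eq by simp
    next
      case False
      then show ?thesis using q(2)[OF pK] by (simp add: L_def)
    qed
    ultimately show ?thesis unfolding is_shortest_tree_def by blast
  qed
qed

lemma shortest_tree:
  fixes p :: "'v \<Rightarrow> 'a::euclidean_space"
  assumes "steiner_topology n G"
  shows "is_shortest_tree G p (shortest_tree G p)"
proof -
  have "\<exists>q. is_shortest_tree G p q"
    using assms by (intro is_shortest_tree_exists) (simp add: steiner_topology_def)
  then show ?thesis unfolding shortest_tree_def by (rule someI_ex)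
qed

section \<open>Approximate Steiner trees\<close>

text \<open>The angle at \<open>s\<close> in \<open>[0, \<pi>]\<close>, meaningful only if \<open>a \<noteq> s\<close> and \<open>b \<noteq> s\<close>.\<close>

definition angle_at :: "'a::real_inner \<Rightarrow> 'a \<Rightarrow> 'a \<Rightarrow> real" where
  "angle_at a s b = arccos (((a - s) \<bullet> (b - s)) / (norm (a - s) * norm (b - s)))"

definition approx_steiner :: "real \<Rightarrow> 'v topology_graph \<Rightarrow> ('v \<Rightarrow> 'a::euclidean_space) \<Rightarrow> bool" where
  "approx_steiner \<epsilon> G p \<longleftrightarrow>
     (\<forall>s\<in>steiner_points G. \<forall>u v. {s, u} \<in> edges G \<and> {s, v} \<in> edges G \<and> u \<noteq> v \<longrightarrow>
        p u \<noteq> p s \<and> p v \<noteq> p s \<and>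
        angle_at (p u) (p s) (p v) \<in> {2 * pi / 3 - \<epsilon> .. 2 * pi / 3 + \<epsilon>})"

text \<open>Vertices are taken to be natural numbers, which loses no topology as all trees are
  finite. The ambient space is \<open>real ^ 'd\<close>, so that \<open>d\<close> is the cardinality of \<open>'d\<close>.\<close>

definition approx_steiner_trees ::
    "real \<Rightarrow> nat \<Rightarrow> (nat topology_graph \<times> (nat \<Rightarrow> real ^ 'd::finite)) set" where
  "approx_steiner_trees \<epsilon> n =
     {(G, p). steiner_topology n G \<and> full_topology G \<and> approx_steiner \<epsilon> G p}"

text \<open>The supremum is taken in the extended reals, so no boundedness is presupposed. If
  \<open>\<epsilon> < 2\<pi>/3\<close> and \<open>n \<ge> 3\<close>, the denominator is positive: two terminals adjacent to a common
  Steiner point are then mapped to distinct points.\<close>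

definition steiner_F :: "'d::finite itself \<Rightarrow> real \<Rightarrow> nat \<Rightarrow> ereal" where
  "steiner_F _ \<epsilon> n =
     (SUP (G, p) \<in> (approx_steiner_trees \<epsilon> n :: (nat topology_graph \<times> (nat \<Rightarrow> real ^ 'd)) set).
        ereal (tree_length G p - tree_length G (shortest_tree G p)) /
        ereal (tree_length G (shortest_tree G p)))"

definition C2 :: "real \<Rightarrow> real" where
  "C2 \<epsilon> = inverse (2 * sin (pi / 3 - \<epsilon> / 2))"

text \<open>\<open>f(n) = \<Omega>(g(n))\<close> for extended-real valued \<open>f\<close>, which the library's \<open>\<Omega>\<close> does not cover.\<close>

definition is_Omega :: "(nat \<Rightarrow> ereal) \<Rightarrow> (nat \<Rightarrow> real) \<Rightarrow> bool" where
  "is_Omega f g \<longleftrightarrow> (\<exists>c>0. \<forall>\<^sub>F n in sequentially. f n \<ge> ereal (c * g n))"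

end

theory Submission
  imports Defs
begin

text \<open>Put \<open>\<delta> = 2\<pi>/3 - \<epsilon>\<close>, so \<open>0 < \<delta> \<le> \<pi>/3\<close>. Since \<open>\<epsilon> \<ge> \<pi>/3\<close>, an angle is admissible as soon as it is at
  least \<open>\<delta>\<close>. The lower bounds come from binary trees whose terminals crowd around the origin
  while their edges are long, so that the star that collapses all Steiner points to the origin
  is very short.

  From a point \<open>v\<close> at distance \<open>R\<close> from the origin, the two tangents to the circle of radius
  \<open>R sin (\<delta>/2)\<close> about the origin enclose exactly the angle \<open>\<delta>\<close>; the two points of tangency are
  the children of \<open>v\<close>. The parent of \<open>v\<close> then lies on the tangent at \<open>v\<close> itself, that is,
  perpendicular to the direction of the origin, so the angles between the parent and the
  children are \<open>\<pi>/2 \<plusminus> \<delta>/2 \<ge> \<delta>\<close>. Only the outermost vertex, at distance \<open>1\<close>, has no such parent: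
  its third neighbour is a terminal at the origin, and its children are the points of tangency
  to the circle of radius \<open>sin \<delta>\<close>, seen from it at angles
  \<open>\<plusminus>\<delta>\<close> to the direction of the origin.

  Each generation doubles the number of vertices and multiplies their distance to the origin
  by \<open>sin (\<delta>/2) = 1 / (2 C\<^sub>2)\<close>. For a tree with \<open>n\<close> terminals that is as balanced as possible,
  the star therefore has length \<open>O(n powr (- \<gamma>))\<close> with \<open>\<gamma> = log\<^sub>2 C\<^sub>2\<close> (\<open>star_length_le\<close>), whereas the
  tree has length at least \<open>1\<close>; the ratio is of order \<open>n\<^sup>\<gamma>\<close>. If \<open>\<epsilon> = \<pi>/3\<close>, then \<open>C\<^sub>2 = 1\<close>, the star
  stays bounded and every generation contributes about the same amount to the length of the
  tree, which is at least \<open>ln n\<close> (\<open>ln_le_heap_length\<close>).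

  Indexing the binary tree as a heap, with parent map \<open>i \<mapsto> i div 2\<close>, yields a full topology with
  any prescribed number \<open>m + 2 \<ge> 2\<close> of terminals.\<close>

section \<open>The heap-shaped topology\<close>

text \<open>The Steiner points are \<open>1, \<dots>, m\<close>, where \<open>i\<close> has the neighbours \<open>i div 2\<close>, \<open>2 i\<close> and
  \<open>2 i + 1\<close>. The terminals are the \<open>m + 1\<close> leaves \<open>m + 1, \<dots>, 2 m + 1\<close> of the heap, together with
  \<open>0\<close>, which hangs on the root \<open>1\<close> of the heap because \<open>1 div 2 = 0\<close>.\<close>

definition heap_edges :: "nat \<Rightarrow> nat set set" where
  "heap_edges m = (\<lambda>i. {i, i div 2}) ` {1..2 * m + 1}"

definition heap_graph :: "nat \<Rightarrow> nat topology_graph" where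
  "heap_graph m = \<lparr>verts = {0..2 * m + 1}, edges = heap_edges m, terms = 0 # [m + 1..<2 * m + 2]\<rparr>"

lemma heap_edges_iff:
  assumes "u < v"
  shows "{u, v} \<in> heap_edges m \<longleftrightarrow> v \<le> 2 * m + 1 \<and> u = v div 2"
  using assms by (auto simp: heap_edges_def image_iff doubleton_eq_iff)

lemma heap_edge_neq: "{v, v} \<notin> heap_edges m"
  by (auto simp: heap_edges_def image_iff)

lemma simple_graph_heap: "simple_graph {0..2 * m + 1} (heap_edges m)"
  unfolding simple_graph_def
proof (intro conjI ballI)
  fix e assume "e \<in> heap_edges m"
  then obtain i where i: "i \<in> {1..2 * m + 1}" "e = {i, i div 2}"
    by (auto simp: heap_edges_def)
  show "\<exists>u\<in>{0..2 * m + 1}. \<exists>v\<in>{0..2 * m + 1}. u \<noteq> v \<and> e = {u, v}"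
    by (rule bexI[of _ i], rule bexI[of _ "i div 2"]) (use i in auto)
qed simp

lemma graph_connected_heap: "graph_connected {0..2 * m + 1} (heap_edges m)"
proof -
  define R where "R = {(x, y). {x, y} \<in> heap_edges m}"
  have sym: "sym (R\<^sup>*)"
    by (intro sym_rtrancl) (auto simp: R_def sym_def insert_commute)
  have root: "(v, 0) \<in> R\<^sup>*" if "v \<le> 2 * m + 1" for v
    using that
  proof (induction v rule: less_induct)
    case (less v)
    show ?case
    proof (cases "v = 0")
      case False
      then have "(v, v div 2) \<in> R"
        using less.prems by (auto simp: R_def heap_edges_def)
      moreover have "(v div 2, 0) \<in> R\<^sup>*"
        using False less.prems by (intro less.IH) auto
      ultimately show ?thesis by (rule converse_rtrancl_into_rtrancl)
    qed simp
  qed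
  have "(u, v) \<in> R\<^sup>*" if "u \<le> 2 * m + 1" "v \<le> 2 * m + 1" for u v
    using root[OF that(1)] symD[OF sym root[OF that(2)]] by (rule rtrancl_trans)
  then show ?thesis by (auto simp: graph_connected_def R_def)
qed

text \<open>The largest vertex of a cycle would have two distinct smaller neighbours, but the only
  smaller neighbour of \<open>v\<close> is \<open>v div 2\<close>.\<close>

lemma heap_acyclic: "\<not> graph_cycle (heap_edges m) c"
proof
  assume "graph_cycle (heap_edges m) c"
  then have len: "length c \<ge> 3" and dist: "distinct c"
    and edge: "\<And>i. i < length c \<Longrightarrow> {c ! i, c ! (Suc i mod length c)} \<in> heap_edges m"
    by (auto simp: graph_cycle_def)
  define n where "n = length c"
  have "Max (set c) \<in> set c" using len by (intro Max_in) auto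
  then obtain j where j: "j < n" "c ! j = Max (set c)"
    by (auto simp: in_set_conv_nth n_def)
  define a where "a = Suc j mod n"
  define b where "b = (if j = 0 then n - 1 else j - 1)"
  have ab: "a < n" "b < n" "Suc b mod n = j"
    using j(1) len by (auto simp: a_def b_def n_def intro!: mod_less_divisor)
  have neq: "a \<noteq> b" "a \<noteq> j" "b \<noteq> j"
    using j(1) len unfolding a_def b_def n_def
    by (cases "Suc j = length c"; auto)+
  have parent: "c ! x = c ! j div 2" if "x < n" "x \<noteq> j" "{c ! x, c ! j} \<in> heap_edges m" for x
  proof -
    have "c ! x \<le> c ! j" using that(1) unfolding j(2) n_def by (intro Max_ge) auto
    moreover have "c ! x \<noteq> c ! j"
      using that(1,2) j(1) dist by (simp add: nth_eq_iff_index_eq n_def)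
    ultimately show ?thesis using that(3) heap_edges_iff[of "c ! x" "c ! j"] by auto
  qed
  have "c ! a = c ! j div 2"
    using parent[OF ab(1) neq(2)] edge[of j] j(1) by (simp add: a_def n_def insert_commute)
  moreover have "c ! b = c ! j div 2"
    using parent[OF ab(2) neq(3)] edge[of b] ab(2,3) by (simp add: n_def)
  ultimately show False
    using ab(1,2) neq(1) dist by (metis n_def nth_eq_iff_index_eq)
qed

lemma inj_on_heap_edge: "inj_on (\<lambda>i::nat. {i, i div 2}) A"
proof (rule inj_onI)
  fix x y :: nat assume "{x, x div 2} = {y, y div 2}"
  moreover have "Max {x, x div 2} = x" "Max {y, y div 2} = y" by auto
  ultimately show "x = y" by metis
qed

lemma graph_degree_heap:
  "graph_degree (heap_edges m) v = card {i\<in>{1..2 * m + 1}. v = i \<or> v = i div 2}"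
proof -
  have "{e \<in> heap_edges m. v \<in> e} =
      (\<lambda>i. {i, i div 2}) ` {i\<in>{1..2 * m + 1}. v = i \<or> v = i div 2}"
    by (auto simp: heap_edges_def)
  then show ?thesis
    by (simp add: graph_degree_def card_image[OF inj_on_heap_edge])
qed

lemma steiner_points_heap: "steiner_points (heap_graph m) = {1..m}"
  by (auto simp: steiner_points_def heap_graph_def)

lemma graph_degree_heap_inner:
  assumes "1 \<le> v" "v \<le> m"
  shows "graph_degree (heap_edges m) v = 3"
proof -
  have "{i\<in>{1..2 * m + 1}. v = i \<or> v = i div 2} = {v, 2 * v, 2 * v + 1}"
    using assms by auto
  then show ?thesis using assms by (simp add: graph_degree_heap)
qed

lemma graph_degree_heap_terminal:
  assumes "v \<in> set (terms (heap_graph m))"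
  shows "graph_degree (heap_edges m) v = 1"
proof -
  have "v = 0 \<or> m + 1 \<le> v \<and> v \<le> 2 * m + 1"
    using assms by (auto simp: heap_graph_def)
  then have "1 \<le> i \<and> i \<le> 2 * m + 1 \<and> (v = i \<or> v = i div 2) \<longleftrightarrow> i = (if v = 0 then 1 else v)" for i
  proof (cases "v = 0")
    case True
    have "0 = i div 2 \<longleftrightarrow> i < 2" by linarith
    then show ?thesis using True by (auto simp: less_2_cases_iff)
  next
    case False
    then have v: "m + 1 \<le> v" "v \<le> 2 * m + 1" using \<open>v = 0 \<or> _\<close> by auto
    have "v \<noteq> i div 2" if "i \<le> 2 * m + 1" using that v(1) by linarith
    then show ?thesis using v False by auto
  qed
  then have "{i\<in>{1..2 * m + 1}. v = i \<or> v = i div 2} = {if v = 0 then 1 else v}"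
    unfolding set_eq_iff mem_Collect_eq atLeastAtMost_iff singleton_iff conj_assoc by blast
  then show ?thesis by (simp add: graph_degree_heap)
qed

lemma steiner_topology_heap: "steiner_topology (m + 2) (heap_graph m)"
proof -
  have "graph_tree (verts (heap_graph m)) (edges (heap_graph m))"
    using simple_graph_heap graph_connected_heap heap_acyclic
    by (simp add: graph_tree_def heap_graph_def)
  moreover have "graph_degree (edges (heap_graph m)) s = 3" if "s \<in> steiner_points (heap_graph m)" for s
    using that graph_degree_heap_inner by (simp add: steiner_points_heap, simp add: heap_graph_def)
  moreover have "graph_degree (edges (heap_graph m)) t \<le> 3" if "t \<in> set (terms (heap_graph m))" for t
    using graph_degree_heap_terminal[OF that] by (simp add: heap_graph_def)
  moreover have "length (terms (heap_graph m)) = m + 2" "distinct (terms (heap_graph m))"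
      "set (terms (heap_graph m)) \<subseteq> verts (heap_graph m)"
    by (auto simp: heap_graph_def)
  ultimately show ?thesis unfolding steiner_topology_def by blast
qed

lemma full_topology_heap: "full_topology (heap_graph m)"
  using graph_degree_heap_terminal by (auto simp: full_topology_def heap_graph_def)

lemma tree_length_heap:
  "tree_length (heap_graph m) p = (\<Sum>i=1..2 * m + 1. dist (p i) (p (i div 2)))"
  by (simp add: tree_length_def heap_graph_def heap_edges_def sum.reindex[OF inj_on_heap_edge]
      edge_length_doubleton)

lemma heap_neighbour:
  assumes "{s, u} \<in> heap_edges m" "s \<ge> 1"
  shows "u = s div 2 \<or> u = 2 * s \<or> u = 2 * s + 1"
proof -
  have "u \<noteq> s" using assms(1) heap_edge_neq by metis
  then consider "u < s" | "s < u" by linarith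
  then show ?thesis
    using assms heap_edges_iff[of u s m] heap_edges_iff[of s u m]
    by cases (auto simp: insert_commute)
qed

section \<open>The drawing with small angles\<close>

text \<open>The angle at the parent of \<open>i\<close> between the directions of \<open>i\<close> and of the origin. It is larger
  for the children \<open>2\<close> and \<open>3\<close> of the root, since the terminal at the origin lies between them.\<close>

definition turn :: "real \<Rightarrow> nat \<Rightarrow> real" where
  "turn \<delta> i = (if i < 4 then \<delta> else \<delta> / 2)"

text \<open>The position of vertex \<open>i\<close>. If the parent is at \<open>v\<close> and \<open>t\<close> is the turn of \<open>i\<close>, then the ray
  from \<open>v\<close> at angle \<open>t\<close> to the direction \<open>- v\<close> of the origin has the direction \<open>- cis (\<plusminus>t) v\<close>, and the
  foot of the perpendicular from the origin to this ray is at distance \<open>\<bar>v\<bar> cos t\<close> from \<open>v\<close>. This foot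
  is the position of \<open>i\<close>; even and odd vertices turn to opposite sides.\<close>

fun heap_point :: "real \<Rightarrow> nat \<Rightarrow> complex" where
  "heap_point \<delta> i =
     (if i = 0 then 0 else if i = 1 then 1
      else (1 - complex_of_real (cos (turn \<delta> i)) * cis (if even i then - turn \<delta> i else turn \<delta> i))
             * heap_point \<delta> (i div 2))"

declare heap_point.simps [simp del]

lemma heap_point_0 [simp]: "heap_point \<delta> 0 = 0"
  and heap_point_1 [simp]: "heap_point \<delta> (Suc 0) = 1"
  by (simp_all add: heap_point.simps)

lemma heap_point_even:
  assumes "i \<ge> 1"
  shows "heap_point \<delta> (2 * i) = (1 - complex_of_real (cos (turn \<delta> (2 * i))) * cis (- turn \<delta> (2 * i))) * heap_point \<delta> i"
  using assms by (subst heap_point.simps) auto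

lemma turn_odd: "turn \<delta> (Suc (2 * i)) = turn \<delta> (2 * i)"
proof -
  have "Suc (2 * i) < 4 \<longleftrightarrow> 2 * i < 4" by presburger
  then show ?thesis by (simp add: turn_def)
qed

lemma heap_point_odd:
  assumes "i \<ge> 1"
  shows "heap_point \<delta> (2 * i + 1) = (1 - complex_of_real (cos (turn \<delta> (2 * i))) * cis (turn \<delta> (2 * i))) * heap_point \<delta> i"
  using assms by (subst heap_point.simps) (auto simp: turn_odd)

text \<open>The foot of the perpendicular has modulus \<open>\<bar>v\<bar> sin t\<close>.\<close>

lemma foot_factor: "1 - complex_of_real (cos t) * cis t = - \<i> * complex_of_real (sin t) * cis t"
  using sin_cos_squared_add[of t] by (simp add: complex_eq_iff power2_eq_square algebra_simps)

lemma foot_factor_neg: "1 - complex_of_real (cos t) * cis (- t) = \<i> * complex_of_real (sin t) * cis (- t)"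
  using foot_factor[of "- t"] by simp

context
  fixes \<delta> :: real
  assumes \<delta>: "0 < \<delta>" "\<delta> \<le> pi / 3"
begin

lemma turn_bounds: "0 < turn \<delta> i" "turn \<delta> i \<le> pi / 3"
  using \<delta> by (auto simp: turn_def)

lemma sin_turn_pos: "0 < sin (turn \<delta> i)" 
  using turn_bounds[of i] pi_gt_zero by (intro sin_gt_zero) linarith+

lemma cos_turn_ge: "1 / 2 \<le> cos (turn \<delta> i)"
  using turn_bounds[of i] pi_gt_zero cos_60 cos_mono_le_eq[of "pi / 3" "turn \<delta> i"] by simp

lemma norm_heap_point:
  assumes "i \<ge> 2"
  shows "norm (heap_point \<delta> i) = sin (turn \<delta> i) * norm (heap_point \<delta> (i div 2))"
proof -
  have "norm (1 - complex_of_real (cos t) * cis (if even i then - t else t)) = \<bar>sin t\<bar>" for t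
    by (simp add: foot_factor foot_factor_neg norm_mult del: cis_mult)
  then show ?thesis
    using assms sin_turn_pos[of i] by (subst heap_point.simps) (auto simp: norm_mult)
qed

lemma dist_heap_point:
  assumes "i \<ge> 2"
  shows "dist (heap_point \<delta> i) (heap_point \<delta> (i div 2)) =
    cos (turn \<delta> i) * norm (heap_point \<delta> (i div 2))"
proof -
  have "heap_point \<delta> i - heap_point \<delta> (i div 2) =
      - (complex_of_real (cos (turn \<delta> i)) * cis (if even i then - turn \<delta> i else turn \<delta> i)) * heap_point \<delta> (i div 2)"
    using assms by (subst heap_point.simps) (auto simp: algebra_simps)
  then show ?thesis
    using cos_turn_ge[of i] by (simp add: dist_norm norm_mult)
qed

lemma heap_point_nonzero: "i \<ge> 1 \<Longrightarrow> heap_point \<delta> i \<noteq> 0"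
proof (induction i rule: less_induct)
  case (less i)
  show ?case
  proof (cases "i = 1")
    case False
    then have "heap_point \<delta> (i div 2) \<noteq> 0" using less by auto
    then have "norm (heap_point \<delta> i) > 0"
      using False less.prems sin_turn_pos[of i] by (subst norm_heap_point) auto
    then show ?thesis by simp
  qed simp
qed

text \<open>The unit direction of the edge from \<open>s\<close> to its neighbour \<open>u\<close>, in the frame in which the
  position of \<open>s\<close> is the positive real axis, so that \<open>-1\<close> is the direction of the origin. The last
  line is the edge to the parent.\<close>

definition toward :: "nat \<Rightarrow> nat \<Rightarrow> complex" where
  "toward s u =
     (if u = 2 * s then - cis (- turn \<delta> (2 * s))
      else if u = 2 * s + 1 then - cis (turn \<delta> (2 * s))
      else if s = 1 then - 1 else if even s then - \<i> else \<i>)"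

lemma norm_toward: "norm (toward s u) = 1"
  by (simp add: toward_def)

text \<open>In the case of a parent the edge is perpendicular to the position of \<open>s\<close>, because \<open>s\<close> is the
  foot of a perpendicular from the origin.\<close>

lemma heap_point_diff:
  assumes "s \<ge> 1" "u = s div 2 \<or> u = 2 * s \<or> u = 2 * s + 1"
  shows "\<exists>r>0. heap_point \<delta> u - heap_point \<delta> s = of_real r * toward s u * heap_point \<delta> s"
proof -
  have cpos: "cos (turn \<delta> i) > 0" for i using cos_turn_ge[of i] by linarith
  consider (even) "u = 2 * s" | (odd) "u = 2 * s + 1" | (root) "s = 1" "u = 0"
    | (up) "s \<ge> 2" "u = s div 2"
    using assms by fastforce
  then show ?thesis
  proof cases
    case even
    then show ?thesis
      using assms(1) cpos by (intro exI[of _ "cos (turn \<delta> (2 * s))"])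
        (simp add: heap_point_even toward_def left_diff_distrib)
  next
    case odd
    then show ?thesis
      using assms(1) cpos by (intro exI[of _ "cos (turn \<delta> (2 * s))"])
        (simp add: heap_point_odd[unfolded Suc_eq_plus1[symmetric]] toward_def left_diff_distrib)
  next
    case root
    then show ?thesis by (intro exI[of _ 1]) (simp add: toward_def)
  next
    case up
    define t where "t = turn \<delta> s"
    define \<sigma> where "\<sigma> = (if even s then - t else t)"
    have st: "sin t > 0" "cos t > 0"
      using sin_turn_pos cpos by (auto simp: t_def)
    have hs: "heap_point \<delta> s = (1 - complex_of_real (cos t) * cis \<sigma>) * heap_point \<delta> u"
      using up by (subst heap_point.simps) (auto simp: t_def \<sigma>_def)
    have tow: "toward s u = (if even s then - \<i> else \<i>)"
      using up by (auto simp: toward_def)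
    have fac: "1 - complex_of_real (cos t) * cis \<sigma> = - toward s u * complex_of_real (sin t) * cis \<sigma>"
      unfolding tow \<sigma>_def by (simp add: foot_factor foot_factor_neg)
    have sq: "toward s u * toward s u = - 1" by (simp add: tow)
    have "heap_point \<delta> u - heap_point \<delta> s = complex_of_real (cos t) * cis \<sigma> * heap_point \<delta> u"
      by (simp add: hs algebra_simps)
    also have "\<dots> = of_real (cos t / sin t) * toward s u * heap_point \<delta> s"
      unfolding hs fac using st sq by (simp add: field_simps)
    finally show ?thesis using st by (intro exI[of _ "cos t / sin t"]) simp
  qed
qed

text \<open>All angles at \<open>s\<close> are at least \<open>\<delta>\<close>. The hypothesis \<open>\<delta> \<le> \<pi>/3\<close> enters through
  \<open>sin (\<delta>/2) \<le> 1/2 \<le> cos \<delta>\<close>, which bounds the angle between the parent and the nearer child.\<close>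

lemma toward_inner_le:
  assumes "s \<ge> 1" "u = s div 2 \<or> u = 2 * s \<or> u = 2 * s + 1"
    "v = s div 2 \<or> v = 2 * s \<or> v = 2 * s + 1" "u \<noteq> v"
  shows "toward s u \<bullet> toward s v \<le> cos \<delta>"
proof -
  define t where "t = turn \<delta> (2 * s)"
  have t: "t = (if s = 1 then \<delta> else \<delta> / 2)" using assms(1) by (auto simp: t_def turn_def)
  have half: "sin (\<delta> / 2) \<le> 1 / 2" "0 \<le> sin (\<delta> / 2)"
    using \<delta> pi_gt_zero sin_mono_le_eq[of "\<delta> / 2" "pi / 6"] sin_30 by (auto intro!: sin_ge_zero)
  have cosd: "1 / 2 \<le> cos \<delta>"
    using \<delta> pi_gt_zero cos_60 cos_mono_le_eq[of "pi / 3" \<delta>] by simp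
  have double: "cos (t * 2) \<le> cos \<delta>"
    using \<delta> pi_gt_zero by (auto simp: t intro!: cos_monotone_0_pi_le)
  have up: "toward s (s div 2) \<bullet> toward s w \<le> cos \<delta>" if "w = 2 * s \<or> w = 2 * s + 1" for w
    using that assms(1) half cosd
    by (auto simp: toward_def inner_complex_def t_def[symmetric] t)
  have kids: "toward s (2 * s) \<bullet> toward s (2 * s + 1) \<le> cos \<delta>"
  proof -
    have "toward s (2 * s) = - cis (- t)" "toward s (2 * s + 1) = - cis t"
      by (simp_all add: toward_def t_def)
    then have "toward s (2 * s) \<bullet> toward s (2 * s + 1) = cos (t * 2)"
      by (simp add: inner_complex_def mult.commute[of t] cos_double power2_eq_square)
    then show ?thesis using double by simp
  qed
  show ?thesis using assms up kids by (metis inner_commute)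
qed

lemma angle_at_scaled:
  fixes a b s d e z :: complex
  assumes "a - s = of_real r * d * z" "b - s = of_real q * e * z" "r > 0" "q > 0" "z \<noteq> 0"
    "norm d = 1" "norm e = 1"
  shows "angle_at a s b = arccos (d \<bullet> e)"
proof -
  have "inner (d * z) (e * z) = (d \<bullet> e) * (norm z)\<^sup>2"
    by (simp add: inner_complex_def cmod_power2) (simp add: power2_eq_square algebra_simps)
  then have "(of_real r * d * z) \<bullet> (of_real q * e * z) = r * q * (norm z)\<^sup>2 * (d \<bullet> e)"
    by (simp add: mult.assoc flip: scaleR_conv_of_real)
  then show ?thesis
    using assms by (simp add: angle_at_def norm_mult power2_eq_square)
qed

lemma heap_angle:
  assumes "s \<ge> 1" "u = s div 2 \<or> u = 2 * s \<or> u = 2 * s + 1"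
    "v = s div 2 \<or> v = 2 * s \<or> v = 2 * s + 1" "u \<noteq> v"
  shows "angle_at (heap_point \<delta> u) (heap_point \<delta> s) (heap_point \<delta> v) \<in> {\<delta>..pi}"
proof -
  obtain r where r: "r > 0" "heap_point \<delta> u - heap_point \<delta> s = of_real r * toward s u * heap_point \<delta> s"
    using heap_point_diff assms by blast
  obtain q where q: "q > 0" "heap_point \<delta> v - heap_point \<delta> s = of_real q * toward s v * heap_point \<delta> s"
    using heap_point_diff assms by blast
  have ang: "angle_at (heap_point \<delta> u) (heap_point \<delta> s) (heap_point \<delta> v) = arccos (toward s u \<bullet> toward s v)"
    by (rule angle_at_scaled[OF r(2) q(2) r(1) q(1) heap_point_nonzero[OF assms(1)] norm_toward norm_toward])
  have "\<bar>toward s u \<bullet> toward s v\<bar> \<le> 1"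
    using Cauchy_Schwarz_ineq2[of "toward s u" "toward s v"] by (simp add: norm_toward)
  then have bd: "- 1 \<le> toward s u \<bullet> toward s v" "toward s u \<bullet> toward s v \<le> 1" by auto
  have "arccos (cos \<delta>) \<le> arccos (toward s u \<bullet> toward s v)"
    using toward_inner_le[OF assms] bd by (intro arccos_le_arccos) auto
  moreover have "arccos (cos \<delta>) = \<delta>" using \<delta> pi_gt_zero by (intro arccos_cos) auto
  ultimately show ?thesis using ang arccos_ubound[OF bd] by simp
qed

lemma approx_steiner_heap:
  assumes "\<epsilon> = 2 * pi / 3 - \<delta>"
  shows "approx_steiner \<epsilon> (heap_graph m) (heap_point \<delta>)"
  unfolding approx_steiner_def
proof (intro ballI allI impI)
  fix s u v
  assume "s \<in> steiner_points (heap_graph m)"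
    and e: "{s, u} \<in> edges (heap_graph m) \<and> {s, v} \<in> edges (heap_graph m) \<and> u \<noteq> v"
  then have s: "s \<ge> 1" by (simp add: steiner_points_heap)
  have nb: "u = s div 2 \<or> u = 2 * s \<or> u = 2 * s + 1" "v = s div 2 \<or> v = 2 * s \<or> v = 2 * s + 1"
    using e heap_neighbour[of s _ m] s by (simp_all add: heap_graph_def)
  have neq: "heap_point \<delta> w \<noteq> heap_point \<delta> s" if "w = s div 2 \<or> w = 2 * s \<or> w = 2 * s + 1" for w
  proof -
    obtain r where "r > 0" "heap_point \<delta> w - heap_point \<delta> s = of_real r * toward s w * heap_point \<delta> s"
      using heap_point_diff[OF s \<open>w = _ \<or> _\<close>] by blast
    moreover have "toward s w \<noteq> 0" using norm_toward[of s w] by auto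
    ultimately show ?thesis using heap_point_nonzero[OF s] by auto
  qed
  show "heap_point \<delta> u \<noteq> heap_point \<delta> s \<and> heap_point \<delta> v \<noteq> heap_point \<delta> s \<and>
      angle_at (heap_point \<delta> u) (heap_point \<delta> s) (heap_point \<delta> v)
        \<in> {2 * pi / 3 - \<epsilon>..2 * pi / 3 + \<epsilon>}"
    using neq nb heap_angle[OF s nb] e \<delta> assms by auto
qed


text \<open>The edge from the root to the terminal at the origin alone has length \<open>1\<close>.\<close>

lemma one_le_heap_length: "1 \<le> tree_length (heap_graph m) (heap_point \<delta>)"
proof -
  have "dist (heap_point \<delta> 1) (heap_point \<delta> (1 div 2)) \<le> tree_length (heap_graph m) (heap_point \<delta>)"
    unfolding tree_length_heap by (intro member_le_sum) auto
  then show ?thesis by simp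
qed

text \<open>Doubling the index divides the distance to the origin by \<open>2\<^sup>a\<close>. The shift \<open>i + 1\<close> makes the
  bound pass from \<open>i\<close> to both \<open>2 i\<close> and \<open>2 i + 1\<close>; the constant accounts for the first two
  generations.\<close>

lemma norm_heap_point_le:
  assumes a: "sin (\<delta> / 2) = 2 powr (- a)" "a \<ge> 0" and "i \<ge> 1"
  shows "norm (heap_point \<delta> i) \<le> 2 * 2 powr a * real (i + 1) powr (- a)"
  using \<open>i \<ge> 1\<close>
proof (induction i rule: less_induct)
  case (less i)
  consider "i = 1" | (small) "i = 2 \<or> i = 3" | (large) "i \<ge> 4" using less.prems by linarith
  then show ?case
  proof cases
    case 1
    then show ?thesis by (simp add: powr_minus mult.assoc)
  next
    case small
    then have "norm (heap_point \<delta> i) = sin \<delta>"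
      by (subst norm_heap_point) (auto simp: turn_def)
    also have "\<dots> \<le> 2 * 2 powr (- a)"
    proof -
      have "sin \<delta> = 2 * sin (\<delta> / 2) * cos (\<delta> / 2)" using sin_double[of "\<delta> / 2"] by simp
      moreover have "sin (\<delta> / 2) * cos (\<delta> / 2) \<le> sin (\<delta> / 2) * 1"
        unfolding a(1) by (intro mult_left_mono) auto
      ultimately show ?thesis using a(1) by simp
    qed
    also have "\<dots> = 2 * 2 powr a * 4 powr (- a)"
    proof -
      have "(4::real) powr (- a) = 2 powr (- a) * 2 powr (- a)"
        using powr_mult[of 2 2 "- a"] by simp
      then show ?thesis by (simp add: powr_minus)
    qed
    also have "\<dots> \<le> 2 * 2 powr a * real (i + 1) powr (- a)"
      using small a(2) by (intro mult_left_mono powr_mono2') auto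
    finally show ?thesis .
  next
    case large
    define j where "j = i div 2"
    have "norm (heap_point \<delta> i) = 2 powr (- a) * norm (heap_point \<delta> j)"
      using large a(1) by (subst norm_heap_point) (auto simp: turn_def j_def)
    also have "\<dots> \<le> 2 powr (- a) * (2 * 2 powr a * real (j + 1) powr (- a))"
      using large less.IH[of j] by (intro mult_left_mono) (auto simp: j_def)
    also have "\<dots> = 2 * 2 powr a * real (2 * (j + 1)) powr (- a)"
      using powr_mult[of 2 "real (j + 1)" "- a"] by simp
    also have "\<dots> \<le> 2 * 2 powr a * real (i + 1) powr (- a)"
    proof -
      have "i + 1 \<le> 2 * (j + 1)" by (auto simp: j_def)
      then have "real (i + 1) \<le> real (2 * (j + 1))" by (rule of_nat_mono)
      then show ?thesis using a(2) by (intro mult_left_mono powr_mono2') auto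
    qed
    finally show ?thesis .
  qed
qed

text \<open>With all Steiner points moved to the origin, only the edges to the leaves have positive
  length. There are \<open>m + 1\<close> of them, one less than the number of terminals.\<close>

lemma star_length_le:
  fixes m :: nat
  assumes "sin (\<delta> / 2) = 2 powr (- (1 + \<gamma>))" "\<gamma> \<ge> 0"
  defines "q \<equiv> \<lambda>i. if i \<in> steiner_points (heap_graph m) then 0 else heap_point \<delta> i"
  shows "tree_length (heap_graph m) q \<le> 2 / sin (\<delta> / 2) * real (m + 2) powr (- \<gamma>)"
proof -
  define K where "K = 2 * 2 powr (1 + \<gamma>)"
  have K: "K = 2 / sin (\<delta> / 2)" "K > 0"
    unfolding K_def assms(1) by (simp_all only: powr_minus divide_inverse inverse_inverse_eq) simp
  have q: "q i = (if i \<le> m then 0 else heap_point \<delta> i)" for i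
    by (cases "i = 0") (auto simp: q_def steiner_points_heap)
  have "tree_length (heap_graph m) q = (\<Sum>i=1..2 * m + 1. norm (q i))"
    unfolding tree_length_heap by (intro sum.cong) (auto simp: q)
  also have "\<dots> = (\<Sum>i=m + 1..2 * m + 1. norm (heap_point \<delta> i))"
    by (intro sum.mono_neutral_cong_right) (auto simp: q)
  also have "\<dots> \<le> (\<Sum>i=m + 1..2 * m + 1. K * real (m + 2) powr (- (1 + \<gamma>)))"
  proof (intro sum_mono)
    fix i assume i: "i \<in> {m + 1..2 * m + 1}"
    have "norm (heap_point \<delta> i) \<le> K * real (i + 1) powr (- (1 + \<gamma>))"
      unfolding K_def using i assms by (intro norm_heap_point_le) auto
    also have "\<dots> \<le> K * real (m + 2) powr (- (1 + \<gamma>))"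
      using i assms(2) K by (intro mult_left_mono powr_mono2') auto
    finally show "norm (heap_point \<delta> i) \<le> K * real (m + 2) powr (- (1 + \<gamma>))" .
  qed
  also have "\<dots> = real (m + 1) * (K * real (m + 2) powr (- (1 + \<gamma>)))" by simp
  also have "\<dots> \<le> real (m + 2) * (K * real (m + 2) powr (- (1 + \<gamma>)))"
    using K by (intro mult_right_mono) auto
  also have "\<dots> = K * (real (m + 2) powr 1 * real (m + 2) powr (- (1 + \<gamma>)))" by simp
  also have "\<dots> = K * real (m + 2) powr (- \<gamma>)"
    by (subst powr_add[symmetric]) simp
  finally show ?thesis using K by simp
qed

end

text \<open>For \<open>\<delta> = \<pi>/3\<close> the distance of vertex \<open>i\<close> to the origin is at least \<open>1/i\<close>, and so is the length of
  the edge from \<open>i\<close> to its parent; the length of the tree dominates a harmonic sum.\<close>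

lemma ln_le_heap_length:
  "ln (real (m + 2)) \<le> tree_length (heap_graph m) (heap_point (pi / 3))"
proof -
  have \<delta>: "0 < pi / 3" "pi / 3 \<le> pi / 3" by auto
  have half: "1 / real i \<le> 1 / 2 * (1 / real (i div 2))" if "i \<ge> 2" for i
  proof -
    have "real (2 * (i div 2)) \<le> real i" by (rule of_nat_mono) simp
    then show ?thesis using that by (simp add: field_simps)
  qed
  have lower: "1 / real i \<le> norm (heap_point (pi / 3) i)" if "i \<ge> 1" for i
    using that
  proof (induction i rule: less_induct)
    case (less i)
    show ?case
    proof (cases "i = 1")
      case False
      define j where "j = i div 2"
      have j: "j \<ge> 1" "2 * j \<le> i" "j < i" using False less.prems by (auto simp: j_def)
      have "sqrt 3 \<ge> 1" by simp
      then have s: "1 / 2 \<le> sin (turn (pi / 3) i)"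
        by (auto simp: turn_def sin_60 sin_30)
      have "1 / real i \<le> 1 / 2 * (1 / real j)"
        unfolding j_def using False less.prems by (intro half) auto
      also have "\<dots> \<le> sin (turn (pi / 3) i) * norm (heap_point (pi / 3) j)"
        using s less.IH[OF j(3,1)] by (intro mult_mono) auto
      also have "\<dots> = norm (heap_point (pi / 3) i)"
        using False less.prems by (subst (2) norm_heap_point[OF \<delta>]) (auto simp: j_def)
      finally show ?thesis .
    qed simp
  qed
  have "ln (real (m + 2)) \<le> ln (real (2 * m + 1) + 1)" by simp
  also have "\<dots> \<le> harm (2 * m + 1)" by (rule ln_le_harm)
  also have "\<dots> = (\<Sum>i=1..2 * m + 1. 1 / real i)" by (simp add: harm_def inverse_eq_divide)
  also have "\<dots> \<le> (\<Sum>i=1..2 * m + 1. dist (heap_point (pi / 3) i) (heap_point (pi / 3) (i div 2)))"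
  proof (intro sum_mono)
    fix i assume i: "i \<in> {1..2 * m + 1}"
    show "1 / real i \<le> dist (heap_point (pi / 3) i) (heap_point (pi / 3) (i div 2))"
    proof (cases "i = 1")
      case False
      then have "1 / real i \<le> 1 / 2 * (1 / real (i div 2))"
        using i by (intro half) auto
      also have "\<dots> \<le> cos (turn (pi / 3) i) * norm (heap_point (pi / 3) (i div 2))"
        using False i lower[of "i div 2"] cos_turn_ge[OF \<delta>, of i] by (intro mult_mono) auto
      also have "\<dots> = dist (heap_point (pi / 3) i) (heap_point (pi / 3) (i div 2))"
        using False i by (subst dist_heap_point[OF \<delta>]) auto
      finally show ?thesis .
    qed simp
  qed
  finally show ?thesis by (simp only: tree_length_heap)
qed


section \<open>Transfer to the coordinate plane\<close>

text \<open>The isometry between the complex plane, where the tree is drawn, and \<open>\<real>\<^sup>2\<close> as a vector space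
  of coordinates.\<close>

definition to_plane :: "complex \<Rightarrow> real ^ 2" where
  "to_plane z = vector [Re z, Im z]"

lemma to_plane_diff: "to_plane x - to_plane y = to_plane (x - y)"
  by (simp add: to_plane_def vec_eq_iff forall_2)

lemma to_plane_inner: "to_plane x \<bullet> to_plane y = x \<bullet> y"
  by (simp add: to_plane_def inner_vec_def sum_2 inner_complex_def)

lemma norm_to_plane: "norm (to_plane x) = norm x"
  by (simp add: norm_eq_sqrt_inner to_plane_inner)

lemma dist_to_plane: "dist (to_plane x) (to_plane y) = dist x y"
  by (simp add: dist_norm to_plane_diff norm_to_plane)

lemma approx_steiner_to_plane:
  assumes "approx_steiner \<epsilon> G p"
  shows "approx_steiner \<epsilon> G (to_plane \<circ> p)"
proof -
  have "to_plane x = to_plane y \<longleftrightarrow> x = y" for x y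
    using dist_to_plane[of x y] by (metis dist_eq_0_iff)
  then show ?thesis
    using assms
    by (simp only: approx_steiner_def angle_at_def comp_apply to_plane_diff to_plane_inner
        norm_to_plane simp_thms)
qed

lemma tree_length_to_plane:
  "tree_length (heap_graph m) (to_plane \<circ> p) = tree_length (heap_graph m) p"
  by (simp add: tree_length_heap dist_to_plane)

section \<open>Lower bounds for the relative error\<close>

text \<open>The relative error of the heap-shaped tree is at least its length divided by that of the
  star, minus \<open>1\<close>.\<close>

lemma steiner_F_ge:
  fixes \<epsilon> \<gamma> :: real
  assumes \<epsilon>: "pi / 3 \<le> \<epsilon>" "\<epsilon> < 2 * pi / 3"
  defines "\<delta> \<equiv> 2 * pi / 3 - \<epsilon>"
  assumes \<gamma>: "sin (\<delta> / 2) = 2 powr (- (1 + \<gamma>))" "\<gamma> \<ge> 0"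
  shows "ereal (tree_length (heap_graph m) (heap_point \<delta>) * real (m + 2) powr \<gamma> * (sin (\<delta> / 2) / 2) - 1)
    \<le> steiner_F TYPE(2) \<epsilon> (m + 2)"
proof -
  define G where "G = heap_graph m"
  define p where "p = to_plane \<circ> heap_point \<delta>"
  define L where "L = tree_length G p"
  define S where "S = tree_length G (shortest_tree G p)"
  define B where "B = 2 / sin (\<delta> / 2) * real (m + 2) powr (- \<gamma>)"
  have \<delta>: "0 < \<delta>" "\<delta> \<le> pi / 3" using \<epsilon> by (auto simp: \<delta>_def)
  have "approx_steiner \<epsilon> G p"
    unfolding G_def p_def using \<delta> by (intro approx_steiner_to_plane approx_steiner_heap[of \<delta>]) (auto simp: \<delta>_def)
  then have mem: "(G, p) \<in> approx_steiner_trees \<epsilon> (m + 2)"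
    using steiner_topology_heap full_topology_heap by (simp add: approx_steiner_trees_def G_def)
  have L: "L = tree_length (heap_graph m) (heap_point \<delta>)"
    by (simp add: L_def G_def p_def tree_length_to_plane)
  then have "1 \<le> L" using one_le_heap_length[OF \<delta>] by simp
  define q where "q = (\<lambda>i. if i \<in> steiner_points G then 0 else heap_point \<delta> i)"
  have "is_shortest_tree G p (shortest_tree G p)"
    unfolding G_def by (rule shortest_tree[OF steiner_topology_heap])
  moreover have "same_terminals G p (to_plane \<circ> q)"
    by (simp add: same_terminals_def p_def q_def steiner_points_def)
  ultimately have "S \<le> tree_length G (to_plane \<circ> q)"
    by (auto simp: is_shortest_tree_def S_def)
  also have "\<dots> \<le> B"
    using star_length_le[OF \<delta> \<gamma>] by (simp add: G_def q_def tree_length_to_plane B_def)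
  finally have "S \<le> B" .
  have "S \<ge> 0" by (simp add: S_def G_def tree_length_heap sum_nonneg)
  have "0 < B" using \<gamma> by (simp add: B_def)
  \<comment> \<open>If \<open>S\<close> were \<open>0\<close>, the quotient of extended reals would be \<open>\<infinity>\<close>, so positivity is not needed.\<close>
  have "ereal (L / B - 1) \<le> ereal (L - S) / ereal S"
  proof (cases "S = 0")
    case True
    then show ?thesis using \<open>1 \<le> L\<close> by (simp add: divide_ereal_def)
  next
    case False
    then have "L / B \<le> L / S"
      using \<open>S \<ge> 0\<close> \<open>S \<le> B\<close> \<open>0 < B\<close> \<open>1 \<le> L\<close> by (intro divide_left_mono) auto
    then show ?thesis using False by (simp add: diff_divide_distrib)
  qed
  also have "\<dots> \<le> steiner_F TYPE(2) \<epsilon> (m + 2)"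
    unfolding steiner_F_def L_def S_def by (rule SUP_upper2[OF mem]) simp
  finally show ?thesis
    using \<gamma> by (simp add: L B_def powr_minus field_simps)
qed

text \<open>As \<open>g\<close> tends to infinity, half of \<open>c g\<close> absorbs the subtracted \<open>1\<close>.\<close>

lemma is_Omega_shift:
  assumes "c > 0" "\<And>m. ereal (c * g (m + 2) - 1) \<le> f (m + 2)" "filterlim g at_top sequentially"
  shows "is_Omega f g"
  unfolding is_Omega_def
proof (intro exI[of _ "c / 2"] conjI)
  have "\<forall>\<^sub>F n in sequentially. 2 / c \<le> g n"
    using assms(3) by (simp add: filterlim_at_top)
  then show "\<forall>\<^sub>F n in sequentially. ereal (c / 2 * g n) \<le> f n"
    using eventually_ge_at_top[of 2]
  proof eventually_elim
    case (elim n)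
    have "c / 2 * g n \<le> c * g n - 1" using elim(1) assms(1) by (simp add: field_simps)
    moreover have "ereal (c * g n - 1) \<le> f n"
      using assms(2)[of "n - 2"] elim(2) by (simp add: numeral_2_eq_2 Suc_diff_Suc)
    ultimately show ?case by (metis ereal_less_eq(3) order_trans)
  qed
qed (use assms in simp)

theorem theorem6p5:
  shows "(\<forall>\<epsilon>. pi / 3 < \<epsilon> \<and> \<epsilon> < 2 * pi / 3 \<longrightarrow>
            is_Omega (\<lambda>n. steiner_F TYPE(2) \<epsilon> n) (\<lambda>n. real n powr (log 2 (C2 \<epsilon>))))
       \<and> is_Omega (\<lambda>n. steiner_F TYPE(2) (pi / 3) n) (\<lambda>n. ln (real n))"
proof (intro conjI allI impI)
  fix \<epsilon> :: real assume \<epsilon>: "pi / 3 < \<epsilon> \<and> \<epsilon> < 2 * pi / 3"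
  define \<delta> where "\<delta> = 2 * pi / 3 - \<epsilon>"
  define \<gamma> where "\<gamma> = log 2 (C2 \<epsilon>)"
  define s where "s = sin (\<delta> / 2)"
  have C2: "C2 \<epsilon> = 1 / (2 * s)" by (simp add: C2_def s_def \<delta>_def diff_divide_distrib inverse_eq_divide)
  have "s > 0" unfolding s_def using \<epsilon> by (intro sin_gt_zero) (auto simp: \<delta>_def)
  have "s < sin (pi / 6)"
    unfolding s_def using \<epsilon> by (intro sin_monotone_2pi) (auto simp: \<delta>_def)
  then have "C2 \<epsilon> > 1" using \<open>s > 0\<close> by (simp add: C2 sin_30 field_simps)
  then have "\<gamma> > 0" by (simp add: \<gamma>_def)
  have s: "s = 2 powr (- (1 + \<gamma>))"
  proof -
    have "2 powr \<gamma> = 1 / (2 * s)" using \<open>C2 \<epsilon> > 1\<close> by (simp add: \<gamma>_def C2[symmetric])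
    then have "2 powr (1 + \<gamma>) = inverse s" by (simp add: powr_add inverse_eq_divide)
    then show ?thesis by (simp only: powr_minus inverse_inverse_eq)
  qed
  show "is_Omega (\<lambda>n. steiner_F TYPE(2) \<epsilon> n) (\<lambda>n. real n powr (log 2 (C2 \<epsilon>)))"
    unfolding \<gamma>_def[symmetric]
  proof (rule is_Omega_shift[of "s / 2"])
    fix m
    define L where "L = tree_length (heap_graph m) (heap_point \<delta>)"
    have "1 \<le> L" unfolding L_def using \<epsilon> by (intro one_le_heap_length) (auto simp: \<delta>_def)
    then have "1 * (s / 2 * real (m + 2) powr \<gamma>) \<le> L * (s / 2 * real (m + 2) powr \<gamma>)"
      using \<open>s > 0\<close> by (intro mult_right_mono) auto
    then have "s / 2 * real (m + 2) powr \<gamma> - 1 \<le> L * real (m + 2) powr \<gamma> * (s / 2) - 1"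
      by (simp add: mult_ac)
    moreover have "ereal (L * real (m + 2) powr \<gamma> * (s / 2) - 1) \<le> steiner_F TYPE(2) \<epsilon> (m + 2)"
      unfolding L_def s_def \<delta>_def
      using \<epsilon> s \<open>\<gamma> > 0\<close> by (intro steiner_F_ge) (auto simp: s_def \<delta>_def)
    ultimately show "ereal (s / 2 * real (m + 2) powr \<gamma> - 1) \<le> steiner_F TYPE(2) \<epsilon> (m + 2)"
      by (metis ereal_less_eq(3) order_trans)
  next
    show "filterlim (\<lambda>n. real n powr \<gamma>) at_top sequentially"
    proof (rule filterlim_cong[OF refl refl, THEN iffD1])
      show "filterlim (\<lambda>n. exp (\<gamma> * ln (real n))) at_top sequentially"
        by (intro filterlim_compose[OF exp_at_top] filterlim_tendsto_pos_mult_at_top[OF tendsto_const \<open>\<gamma> > 0\<close>]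
            filterlim_compose[OF ln_at_top] filterlim_real_sequentially)
      show "\<forall>\<^sub>F n in sequentially. exp (\<gamma> * ln (real n)) = real n powr \<gamma>"
        using eventually_gt_at_top[of 0] by eventually_elim (simp add: powr_def)
    qed
  qed (use \<open>s > 0\<close> in simp)
next
  show "is_Omega (\<lambda>n. steiner_F TYPE(2) (pi / 3) n) (\<lambda>n. ln (real n))"
  proof (rule is_Omega_shift[of "1 / 4"])
    fix m
    have \<delta>: "2 * pi / 3 - pi / 3 = pi / 3" by simp
    define L where "L = tree_length (heap_graph m) (heap_point (pi / 3))"
    have "ereal (L * real (m + 2) powr 0 * (sin (pi / 3 / 2) / 2) - 1) \<le> steiner_F TYPE(2) (pi / 3) (m + 2)"
      using steiner_F_ge[of "pi / 3" 0 m, unfolded \<delta>] by (simp add: L_def sin_30 powr_minus)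
    then have "ereal (L / 4 - 1) \<le> steiner_F TYPE(2) (pi / 3) (m + 2)"
      by (simp add: sin_30)
    moreover have "1 / 4 * ln (real (m + 2)) - 1 \<le> L / 4 - 1"
      using ln_le_heap_length[of m] by (simp add: L_def)
    ultimately show "ereal (1 / 4 * ln (real (m + 2)) - 1) \<le> steiner_F TYPE(2) (pi / 3) (m + 2)"
      by (metis ereal_less_eq(3) order_trans)
  next
    show "filterlim (\<lambda>n. ln (real n)) at_top sequentially"
      by (rule filterlim_compose[OF ln_at_top filterlim_real_sequentially])
  qed simp
qed

end
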